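(* Let $A$ be a semisimple complex Banach algebra with identity and $\mathrm{Soc}\,A\neq\{0\}$. Then $\mathrm{Soc}\,A\subseteq Z(A)$ if and only if $\dim aAa=\mathrm{rank}(a)$ for all $a\in\mathrm{Soc}\,A$.
   Context: $Z(A)=\{x\in A: xy=yx\text{ for all }y\in A\}$ is the center of $A$. For $x\in A$, $\sigma(x)$ is the spectrum and $\sigma'(x)=\sigma(x)\setminus\{0\}$. The rank of $a\in A$ is $\mathrm{rank}(a)=\sup_{x\in A}\#\sigma'(xa)\in\{0,1,2,\dots\}\cup\{\infty\}$. $\mathrm{Soc}\,A$ is the socle of $A$ (the sum of all minimal left ideals, $\{0\}$ if there are none); for semisimple $A$ it coincides with the set of elements of finite rank. $aAa=\{axa:x\in A\}$ and $\dim$ is complex vector space dimension. *)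

theory Defs
  imports Complex_Main "HOL-Library.Extended_Nat"
begin

(* The identity is not required to have norm 1; only submultiplicativity of the norm is assumed.
   The real scaling that the class banach carries is the restriction of scaleC. *)
class complex_banach_algebra_1 = banach + real_normed_algebra + ring_1 +
  fixes scaleC :: "complex \<Rightarrow> 'a \<Rightarrow> 'a" (infixr "*\<^sub>C" 75)
  assumes scaleR_scaleC: "r *\<^sub>R x = complex_of_real r *\<^sub>C x"
    and scaleC_add_right: "c *\<^sub>C (x + y) = c *\<^sub>C x + c *\<^sub>C y"
    and scaleC_add_left: "(c + d) *\<^sub>C x = c *\<^sub>C x + d *\<^sub>C x"
    and scaleC_scaleC: "c *\<^sub>C d *\<^sub>C x = (c * d) *\<^sub>C x"
    and scaleC_one: "1 *\<^sub>C x = x"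
    and mult_scaleC_left: "(c *\<^sub>C x) * y = c *\<^sub>C (x * y)"
    and mult_scaleC_right: "x * (c *\<^sub>C y) = c *\<^sub>C (x * y)"
    and norm_scaleC: "norm (c *\<^sub>C x) = cmod c * norm x"

instantiation complex :: complex_banach_algebra_1
begin

definition scaleC_complex :: "complex \<Rightarrow> complex \<Rightarrow> complex"
  where "scaleC_complex c x = c * x"

instance
  by standard (simp_all add: scaleC_complex_def scaleR_conv_of_real algebra_simps norm_mult)

end

global_interpretation complex_vector:
  vector_space "scaleC :: complex \<Rightarrow> 'a \<Rightarrow> 'a::complex_banach_algebra_1"
  by unfold_locales
    (simp_all add: scaleC_add_right scaleC_add_left scaleC_scaleC scaleC_one)

(* The library's dim and card return 0 in the infinite case; these versions return infinity. *)
definition complex_dim :: "'a::complex_banach_algebra_1 set \<Rightarrow> enat"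
  where "complex_dim S =
    (if \<exists>B. finite B \<and> S \<subseteq> complex_vector.span B then enat (complex_vector.dim S) else \<infinity>)"

definition extended_card :: "'b set \<Rightarrow> enat"
  where "extended_card S = (if finite S then enat (card S) else \<infinity>)"

definition algebra_center :: "'a::complex_banach_algebra_1 set"
  where "algebra_center = {x. \<forall>y. x * y = y * x}"

definition algebra_spectrum :: "'a::complex_banach_algebra_1 \<Rightarrow> complex set"
  where "algebra_spectrum x =
    {c. \<not> (\<exists>y. (x - c *\<^sub>C 1) * y = 1 \<and> y * (x - c *\<^sub>C 1) = 1)}"

definition nonzero_spectrum :: "'a::complex_banach_algebra_1 \<Rightarrow> complex set"
  where "nonzero_spectrum x = algebra_spectrum x - {0}"

definition spectral_rank :: "'a::complex_banach_algebra_1 \<Rightarrow> enat"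
  where "spectral_rank a = (SUP x. extended_card (nonzero_spectrum (x * a)))"

definition left_ideal :: "'a::complex_banach_algebra_1 set \<Rightarrow> bool"
  where "left_ideal L \<longleftrightarrow> complex_vector.subspace L \<and> (\<forall>a. \<forall>x\<in>L. a * x \<in> L)"

definition minimal_left_ideal :: "'a::complex_banach_algebra_1 set \<Rightarrow> bool"
  where "minimal_left_ideal L \<longleftrightarrow>
    left_ideal L \<and> L \<noteq> {0} \<and> (\<forall>J. left_ideal J \<and> J \<subseteq> L \<longrightarrow> J = {0} \<or> J = L)"

definition maximal_left_ideal :: "'a::complex_banach_algebra_1 set \<Rightarrow> bool"
  where "maximal_left_ideal L \<longleftrightarrow>
    left_ideal L \<and> L \<noteq> UNIV \<and> (\<forall>J. left_ideal J \<and> L \<subseteq> J \<longrightarrow> J = L \<or> J = UNIV)"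

definition jacobson_radical :: "'a::complex_banach_algebra_1 set"
  where "jacobson_radical = \<Inter>{L. maximal_left_ideal L}"

definition semisimple_algebra :: "'a::complex_banach_algebra_1 itself \<Rightarrow> bool"
  where "semisimple_algebra (_ :: 'a itself) \<longleftrightarrow> (jacobson_radical :: 'a set) = {0}"

(* The sum of a family of subspaces is the span of its union; the empty family gives {0}. *)
definition socle :: "'a::complex_banach_algebra_1 set"
  where "socle = complex_vector.span (\<Union>{L. minimal_left_ideal L})"

end

(* In a semisimple algebra a minimal left ideal is Ae with e idempotent and, by Gelfand-Mazur,
   eAe = Ce. If the socle is central, then Ae = Ce, so an element a of the socle is a combination of
   n orthogonal idempotents with nonzero coefficients; then aAa is their span, and an element xa is
   again such a combination, whose nonzero spectrum consists of its nonzero coefficients. Hence both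
   sides equal n. Conversely, if u = (1 - e)xe is nonzero, minimality of Ae gives v in eA(1 - e) with
   vu = e, and e, u, v, uv span a copy of the 2 by 2 matrices inside A. Its unit a = e + uv lies in
   the socle and has rank at most 2 by Cayley-Hamilton, but e, u, v are independent in aAa. So
   (1 - e)Ae = 0; then each y in eA(1 - e) satisfies yAy = 0, whence y = 0, and e is central. *)
theory Submission
  imports Defs "HOL-Analysis.Analysis"
begin

section \<open>A Gelfand--Mazur theorem for corners\<close>

text \<open>Makes the calculus of bounded bilinear maps (continuity, bounded linearity in each
  argument) available for the complex scaling.\<close>

lemma bounded_bilinear_scaleC:
  "bounded_bilinear (scaleC :: complex \<Rightarrow> 'a \<Rightarrow> 'a::complex_banach_algebra_1)"
proof
  fix r :: real and c :: complex and x :: 'a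
  show "(r *\<^sub>R c) *\<^sub>C x = r *\<^sub>R (c *\<^sub>C x)"
    unfolding scaleR_conv_of_real by (simp add: scaleR_scaleC scaleC_scaleC)
  show "c *\<^sub>C (r *\<^sub>R x) = r *\<^sub>R (c *\<^sub>C x)"
    by (simp add: scaleR_scaleC scaleC_scaleC mult.commute)
  show "\<exists>K. \<forall>(c::complex) (x::'a). norm (c *\<^sub>C x) \<le> norm c * norm x * K"
    by (rule exI[of _ 1]) (simp add: norm_scaleC)
qed (simp_all add: scaleC_add_left scaleC_add_right)

lemmas continuous_on_scaleC = bounded_bilinear.continuous_on[OF bounded_bilinear_scaleC]

text \<open>The identity bounds \<open>norm (R l - R m)\<close> by
  \<open>cmod (l - m) * norm (R l) * norm (R m)\<close>. Near \<open>m\<close> the term with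
  \<open>R l\<close> can be absorbed, which gives \<open>norm (R l) \<le> 2 * norm (R m)\<close>, so
  the difference tends to 0.\<close>

lemma pseudo_resolvent_isCont:
  fixes R :: "complex \<Rightarrow> 'a::complex_banach_algebra_1"
  assumes res: "\<And>l m. R l - R m = (l - m) *\<^sub>C (R l * R m)"
  shows "isCont R m"
proof -
  have diff: "norm (R l - R m) \<le> cmod (l - m) * (norm (R l) * norm (R m))" for l
    by (subst res) (simp add: norm_scaleC mult_left_mono norm_mult_ineq)
  have bd: "norm (R l - R m) \<le> cmod (l - m) * (2 * norm (R m) * norm (R m))"
    if l: "cmod (l - m) * norm (R m) < 1/2" for l
  proof -
    have "norm (R l) \<le> norm (R m) + norm (R l - R m)"
      using norm_triangle_sub[of "R l" "R m"] by simp
    also have "\<dots> \<le> norm (R m) + (cmod (l - m) * norm (R m)) * norm (R l)"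
      using diff[of l] by (simp add: mult_ac)
    also have "\<dots> \<le> norm (R m) + 1/2 * norm (R l)"
      using l by (intro add_left_mono mult_right_mono) auto
    finally have "norm (R l) \<le> 2 * norm (R m)" by simp
    then show ?thesis
      by (intro order.trans[OF diff] mult_left_mono mult_right_mono) auto
  qed
  have "((\<lambda>l. cmod (l - m) * norm (R m)) \<longlongrightarrow> cmod (m - m) * norm (R m)) (at m)"
    by (intro tendsto_intros)
  then have "\<forall>\<^sub>F l in at m. cmod (l - m) * norm (R m) < 1/2"
    by (rule order_tendstoD(2)) simp
  then have ev: "\<forall>\<^sub>F l in at m. norm (R l - R m) \<le> cmod (l - m) * (2 * norm (R m) * norm (R m))"
    by eventually_elim (rule bd)
  have "((\<lambda>l. cmod (l - m) * (2 * norm (R m) * norm (R m))) \<longlongrightarrow>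
      cmod (m - m) * (2 * norm (R m) * norm (R m))) (at m)"
    by (intro tendsto_intros)
  then have "((\<lambda>l. R l - R m) \<longlongrightarrow> 0) (at m)"
    by (intro Lim_null_comparison[OF ev]) simp
  then show ?thesis
    by (simp add: isCont_def LIM_zero_iff)
qed

text \<open>The difference quotient is \<open>R l * R m\<close>, which tends to
  \<open>R m * R m\<close> by continuity.\<close>

lemma pseudo_resolvent_has_derivative:
  fixes R :: "complex \<Rightarrow> 'a::complex_banach_algebra_1"
  assumes res: "\<And>l m. R l - R m = (l - m) *\<^sub>C (R l * R m)"
  shows "(R has_derivative (\<lambda>h. h *\<^sub>C (R m * R m))) (at m)"
proof (rule has_derivativeI_sandwich[where e = 1])
  show "bounded_linear (\<lambda>h. h *\<^sub>C (R m * R m))"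
    by (rule bounded_bilinear.bounded_linear_left[OF bounded_bilinear_scaleC])
next
  have "((\<lambda>l. norm (R l - R m) * norm (R m)) \<longlongrightarrow> norm (R m - R m) * norm (R m)) (at m)"
    using pseudo_resolvent_isCont[of R m] res unfolding isCont_def by (intro tendsto_intros) auto
  then show "((\<lambda>l. norm (R l - R m) * norm (R m)) \<longlongrightarrow> 0) (at m)"
    by simp
next
  fix l assume "l \<noteq> m"
  have "R l - R m - (l - m) *\<^sub>C (R m * R m) = (l - m) *\<^sub>C ((R l - R m) * R m)"
    by (subst res) (simp add: left_diff_distrib complex_vector.scale_right_diff_distrib)
  then have "norm (R l - R m - (l - m) *\<^sub>C (R m * R m)) \<le> cmod (l - m) * (norm (R l - R m) * norm (R m))"
    by (simp add: norm_scaleC mult_left_mono norm_mult_ineq)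
  then show "norm (R l - R m - (l - m) *\<^sub>C (R m * R m)) / norm (l - m) \<le> norm (R l - R m) * norm (R m)"
    using \<open>l \<noteq> m\<close> by (simp add: divide_le_eq mult.commute)
qed auto

text \<open>Liouville's theorem without functionals: the mean of \<open>R\<close> over the circle of radius \<open>r\<close> does not
  depend on \<open>r\<close>, because its \<open>r\<close>-derivative is the integral of a multiple of the \<open>t\<close>-derivative
  of \<open>R (r * cis t)\<close>.\<close>
lemma pseudo_resolvent_zero:
  fixes R :: "complex \<Rightarrow> 'a::complex_banach_algebra_1"
  assumes res: "\<And>l m. R l - R m = (l - m) *\<^sub>C (R l * R m)"
    and lim: "(R \<longlongrightarrow> 0) at_infinity"
  shows "R l = 0"
proof -
  have cont: "continuous_on S R" for S
    using pseudo_resolvent_isCont[of R] res by (meson continuous_at_imp_continuous_on)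
  note contR = continuous_on_compose2[OF cont[of UNIV] _ subset_UNIV]
  define f where "f r t = R (complex_of_real r * cis t)" for r t
  \<comment> \<open>\<open>g\<close> is the \<open>r\<close>-derivative of \<open>f\<close>. The
    \<open>t\<close>-derivative is \<open>\<i> * r\<close> times it: the Cauchy-Riemann equations in
    polar form.\<close>
  define g where "g r t = cis t *\<^sub>C (f r t * f r t)" for r t
  have cf: "continuous_on S (f r)" for r S
    unfolding f_def by (intro contR continuous_intros)
  have dr: "((\<lambda>r. f r t) has_vector_derivative g r t) (at r)" for r t
  proof -
    have "((\<lambda>r. complex_of_real r * cis t) has_derivative (\<lambda>h. complex_of_real h * cis t)) (at r)"
      by (auto intro!: derivative_eq_intros)
    from diff_chain_at[OF this pseudo_resolvent_has_derivative[of R, OF res]]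
    show ?thesis
      by (simp add: has_vector_derivative_def o_def f_def g_def scaleR_scaleC scaleC_scaleC)
  qed
  have dt: "(f r has_vector_derivative (\<i> * complex_of_real r) *\<^sub>C g r t) (at t)" for r t
  proof -
    have "((\<lambda>t. complex_of_real r * cis t) has_derivative
        (\<lambda>h. complex_of_real r * (complex_of_real h * (\<i> * cis t)))) (at t)"
      unfolding scaleR_conv_of_real[symmetric] by (auto intro!: derivative_eq_intros)
    from diff_chain_at[OF this pseudo_resolvent_has_derivative[of R, OF res]]
    show ?thesis
      by (simp add: has_vector_derivative_def o_def f_def[abs_def] g_def scaleR_scaleC scaleC_scaleC
          mult_ac)
  qed
  have "continuous_on (UNIV \<times> cbox 0 (2*pi)) (\<lambda>(r, t). g r t)"
    unfolding g_def f_def split_beta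
    by (intro continuous_on_scaleC continuous_intros contR)
  then have dF: "((\<lambda>r. integral (cbox 0 (2*pi)) (f r)) has_vector_derivative
      integral (cbox 0 (2*pi)) (g r)) (at r)" for r
    using leibniz_rule_vector_derivative[of UNIV 0 "2*pi" f g r] dr
    by (simp add: integrable_continuous_interval cf)
  \<comment> \<open>Up to the nonzero factor \<open>\<i> * r\<close>, this integral is
    \<open>f r (2*pi) - f r 0\<close>, which vanishes because the circle closes.\<close>
  have int_g: "integral (cbox 0 (2*pi)) (g r) = 0" if "r \<noteq> 0" for r
  proof -
    have cg: "continuous_on {0..2*pi} (g r)"
      unfolding g_def by (intro continuous_on_scaleC continuous_intros cf)
    have "((\<lambda>t. (\<i> * complex_of_real r) *\<^sub>C g r t) has_integral (f r (2*pi) - f r 0)) {0..2*pi}"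
      by (rule fundamental_theorem_of_calculus)
        (auto intro: has_vector_derivative_at_within dt)
    then have "integral {0..2*pi} (scaleC (\<i> * complex_of_real r) \<circ> g r) = 0"
      by (simp add: f_def o_def has_integral_iff)
    then have "(\<i> * complex_of_real r) *\<^sub>C integral {0..2*pi} (g r) = 0"
      using integral_linear[OF integrable_continuous_interval[OF cg]
          bounded_bilinear.bounded_linear_right[OF bounded_bilinear_scaleC]] by metis
    then show ?thesis
      using that by simp
  qed
  let ?F = "\<lambda>r. integral {0..2*pi} (f r)"
  have dF': "(?F has_vector_derivative integral {0..2*pi} (g r)) (at r)" for r
    using dF[of r] by simp
  \<comment> \<open>The derivative is known to vanish only for \<open>r \<noteq> 0\<close>; at the
    exceptional point 0 continuity suffices. The constant is read off from the degenerate circle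
    \<open>r = 0\<close>.\<close>
  have const: "?F r = (2*pi) *\<^sub>R R 0" if "r \<ge> 0" for r
  proof (rule has_derivative_zero_unique_strong_interval[of "{0}" 0 r])
    show "continuous_on {0..r} ?F"
      by (intro continuous_at_imp_continuous_on ballI has_vector_derivative_continuous[OF dF'])
    show "?F 0 = (2*pi) *\<^sub>R R 0"
      by (simp add: f_def[abs_def])
    show "(?F has_derivative (\<lambda>h. 0)) (at x within {0..r})" if "x \<in> {0..r} - {0}" for x
      using dF'[of x] int_g[of x] that
      by (auto simp: has_vector_derivative_def intro: has_derivative_at_withinI)
  qed (use that in auto)
  \<comment> \<open>On a large circle \<open>R\<close> is below \<open>e\<close>, hence so is its
    mean, which is \<open>R 0\<close>. Once \<open>R 0 = 0\<close>, the identity with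
    \<open>m = 0\<close> kills every \<open>R l\<close>.\<close>
  have "norm (R 0) \<le> e" if e: "e > 0" for e
  proof -
    obtain b where b: "\<And>l. b \<le> cmod l \<Longrightarrow> norm (R l) < e"
      using tendstoD[OF lim e] unfolding eventually_at_infinity dist_norm diff_zero by blast
    have "norm (f \<bar>b\<bar> t) \<le> e" for t
      unfolding f_def by (rule less_imp_le[OF b]) (simp add: norm_mult)
    then have "norm (?F \<bar>b\<bar>) \<le> e * (2*pi - 0)"
      by (intro integral_bound cf) auto
    then show ?thesis
      by (simp add: const)
  qed
  then have "norm (R 0) \<le> 0"
    by (rule dense_ge)
  then have "R 0 = 0"
    by simp
  then show ?thesis
    using res[of l 0] by simp
qed

text \<open>Gelfand-Mazur for \<open>eAe\<close>: if \<open>z\<close> were not a multiple of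
  \<open>e\<close>, every \<open>z - l *\<^sub>C e\<close> would be invertible in the corner. The
  inverses satisfy the resolvent identity and vanish at infinity, so they are zero, contradicting
  \<open>e \<noteq> 0\<close>.\<close>

lemma corner_scalar:
  fixes e z :: "'a::complex_banach_algebra_1"
  assumes e: "e * e = e"
    and div: "\<And>z. e * z = z \<Longrightarrow> z * e = z \<Longrightarrow> z \<noteq> 0 \<Longrightarrow> \<exists>w. w * z = e"
    and z: "e * z = z" "z * e = z"
  shows "\<exists>c. z = c *\<^sub>C e"
proof (rule ccontr)
  assume contra: "\<nexists>c. z = c *\<^sub>C e"
  then have "e \<noteq> 0"
    using z by auto
  have left: "\<exists>w. e * w = w \<and> w * e = w \<and> w \<noteq> 0 \<and> w * x = e"
    if x: "e * x = x" "x * e = x" "x \<noteq> 0" for x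
  proof -
    obtain w where "w * x = e"
      using div x by blast
    \<comment> \<open>Compressing by \<open>e\<close> moves the left inverse into the
      corner.\<close>
    then have "(e * w * e) * x = e"
      using x e by (metis mult.assoc)
    moreover from this have "e * w * e \<noteq> 0"
      using \<open>e \<noteq> 0\<close> by auto
    ultimately show ?thesis
      using e by (intro exI[of _ "e * w * e"]) (metis mult.assoc)
  qed
  have inv: "\<exists>w. e * w = w \<and> w * e = w \<and> w * x = e \<and> x * w = e"
    if x: "e * x = x" "x * e = x" "x \<noteq> 0" for x
  proof -
    obtain w where w: "e * w = w" "w * e = w" "w \<noteq> 0" "w * x = e"
      using left[OF x] by blast
    obtain v where v: "e * v = v" "v * e = v" "v * w = e"
      using left[OF w(1-3)] by blast
    \<comment> \<open>A left inverse \<open>v\<close> of the left inverse \<open>w\<close> of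
      \<open>x\<close> equals \<open>x\<close>, so \<open>w\<close> is a two-sided inverse.\<close>
    have "v = x"
      using v w x by (metis mult.assoc)
    then show ?thesis
      using v w by blast
  qed
  have "\<exists>w. e * w = w \<and> w * e = w \<and> w * (z - l *\<^sub>C e) = e \<and> (z - l *\<^sub>C e) * w = e" for l
    using contra z e
    by (intro inv) (auto simp: algebra_simps mult_scaleC_left mult_scaleC_right)
  then obtain R where R: "\<And>l. e * R l = R l" "\<And>l. R l * e = R l"
      "\<And>l. R l * (z - l *\<^sub>C e) = e" "\<And>l. (z - l *\<^sub>C e) * R l = e"
    by metis
  have res: "R l - R m = (l - m) *\<^sub>C (R l * R m)" for l m
  proof -
    have "R l - R m = R l * ((z - m *\<^sub>C e) * R m) - R l * (z - l *\<^sub>C e) * R m"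
      by (simp add: R)
    also have "\<dots> = R l * ((l - m) *\<^sub>C e) * R m"
      by (simp add: algebra_simps mult_scaleC_left mult_scaleC_right
          complex_vector.scale_left_diff_distrib)
    also have "\<dots> = (l - m) *\<^sub>C (R l * R m)"
      by (simp add: mult_scaleC_left mult_scaleC_right R mult.assoc)
    finally show ?thesis .
  qed
  have bound: "norm (R l) \<le> norm e / (cmod l - norm z)" if "cmod l > norm z" for l
  proof -
    have "l *\<^sub>C R l = R l * z - e"
      using R(3)[of l] R(2)[of l] by (simp add: algebra_simps mult_scaleC_right)
    then have "cmod l * norm (R l) = norm (R l * z - e)"
      by (metis norm_scaleC)
    also have "\<dots> \<le> norm (R l) * norm z + norm e"
      by (meson norm_triangle_ineq4 norm_mult_ineq add_right_mono order.trans)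
    finally show ?thesis
      using that by (simp add: field_simps)
  qed
  have "(R \<longlongrightarrow> 0) at_infinity"
  proof (rule Lim_null_comparison)
    show "\<forall>\<^sub>F l in at_infinity. norm (R l) \<le> norm e / (cmod l - norm z)"
      unfolding eventually_at_infinity by (rule exI[of _ "norm z + 1"]) (auto intro: bound)
    have "filterlim (\<lambda>l. - norm z + cmod l) at_top at_infinity"
      by (intro filterlim_tendsto_add_at_top[OF tendsto_const] filterlim_norm_at_top)
    then show "((\<lambda>l. norm e / (cmod l - norm z)) \<longlongrightarrow> 0) at_infinity"
      by (intro tendsto_divide_0[OF tendsto_const] filterlim_at_top_imp_at_infinity) simp
  qed
  then have "R 0 = 0"
    by (rule pseudo_resolvent_zero[OF res])
  then show False
    using R(3)[of 0] \<open>e \<noteq> 0\<close> by simp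
qed

section \<open>Minimal left ideals in semisimple algebras\<close>

lemma left_idealD:
  assumes "left_ideal L"
  shows "0 \<in> L" "\<And>x y. x \<in> L \<Longrightarrow> y \<in> L \<Longrightarrow> x + y \<in> L" "\<And>x c. x \<in> L \<Longrightarrow> c *\<^sub>C x \<in> L"
    "\<And>x y. x \<in> L \<Longrightarrow> y \<in> L \<Longrightarrow> x - y \<in> L" "\<And>a x. x \<in> L \<Longrightarrow> a * x \<in> L"
  using assms unfolding left_ideal_def
  by (auto intro: complex_vector.subspace_0 complex_vector.subspace_add
      complex_vector.subspace_scale complex_vector.subspace_diff)

lemma left_idealI:
  assumes "0 \<in> L" "\<And>x y. x \<in> L \<Longrightarrow> y \<in> L \<Longrightarrow> x + y \<in> L" "\<And>x c. x \<in> L \<Longrightarrow> c *\<^sub>C x \<in> L"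
    "\<And>a x. x \<in> L \<Longrightarrow> a * x \<in> L"
  shows "left_ideal L"
  using assms unfolding left_ideal_def complex_vector.subspace_def by blast

lemma left_ideal_image_mult_right:
  assumes L: "left_ideal L"
  shows "left_ideal ((\<lambda>x. x * v) ` L)"
proof (rule left_idealI)
  show "0 \<in> (\<lambda>x. x * v) ` L"
    using left_idealD(1)[OF L] by (rule rev_image_eqI) simp
  show "y + z \<in> (\<lambda>x. x * v) ` L" if "y \<in> (\<lambda>x. x * v) ` L" "z \<in> (\<lambda>x. x * v) ` L" for y z
    using that left_idealD(2)[OF L] by (force simp flip: distrib_right)
  show "c *\<^sub>C y \<in> (\<lambda>x. x * v) ` L" if "y \<in> (\<lambda>x. x * v) ` L" for y c
    using that left_idealD(3)[OF L] by (force simp flip: mult_scaleC_left)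
  show "a * y \<in> (\<lambda>x. x * v) ` L" if "y \<in> (\<lambda>x. x * v) ` L" for a y
    using that left_idealD(5)[OF L] by (force simp flip: mult.assoc)
qed

lemma left_ideal_principal: "left_ideal (range (\<lambda>a. a * (x::'a::complex_banach_algebra_1)))"
  by (rule left_ideal_image_mult_right) (simp add: left_ideal_def complex_vector.subspace_UNIV)

lemma left_ideal_vimage_mult_right:
  assumes L: "left_ideal L" and J: "left_ideal J"
  shows "left_ideal {x \<in> L. x * v \<in> J}"
  using left_idealD[OF L] left_idealD[OF J]
  by (intro left_idealI) (simp_all add: distrib_right mult_scaleC_left mult.assoc)

text \<open>Such an ideal lies in the radical: if a maximal \<open>M\<close> missed
  \<open>x\<close>, then \<open>M + L\<close> would be everything and \<open>1 = m + l\<close>.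
  Since \<open>l * l = 0\<close>, \<open>1 + l\<close> is a left inverse of \<open>m\<close>, which
  forces \<open>M = UNIV\<close>.\<close>

lemma semisimple_square_zero_left_ideal:
  assumes ss: "semisimple_algebra TYPE('a::complex_banach_algebra_1)"
    and L: "left_ideal (L :: 'a set)" and sq: "\<And>x y. x \<in> L \<Longrightarrow> y \<in> L \<Longrightarrow> x * y = 0"
    and x: "x \<in> L"
  shows "x = 0"
proof -
  have "x \<in> M" if M: "maximal_left_ideal M" for M
  proof (rule ccontr)
    assume "x \<notin> M"
    have M_ideal: "left_ideal M" and "M \<noteq> UNIV"
      using M by (auto simp: maximal_left_ideal_def)
    define J where "J = {m + l | m l. m \<in> M \<and> l \<in> L}"
    have "left_ideal J"
    proof (rule left_idealI)
      show "0 \<in> J"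
        unfolding J_def using left_idealD(1)[OF M_ideal] left_idealD(1)[OF L] by force
      show "y + z \<in> J" if yz: "y \<in> J" "z \<in> J" for y z
      proof -
        obtain m l m' l' where "y = m + l" "z = m' + l'" "m \<in> M" "l \<in> L" "m' \<in> M" "l' \<in> L"
          using yz by (auto simp: J_def)
        moreover from this have "y + z = (m + m') + (l + l')"
          by simp
        ultimately show ?thesis
          unfolding J_def using left_idealD(2)[OF M_ideal] left_idealD(2)[OF L] by blast
      qed
      show "c *\<^sub>C y \<in> J" if "y \<in> J" for y c
        using that left_idealD(3)[OF M_ideal] left_idealD(3)[OF L]
        by (force simp: J_def scaleC_add_right)
      show "a * y \<in> J" if "y \<in> J" for a y
        using that left_idealD(5)[OF M_ideal] left_idealD(5)[OF L]
        by (force simp: J_def distrib_left)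
    qed
    moreover have "M \<subseteq> J"
      unfolding J_def using left_idealD(1)[OF L] by force
    moreover have "x \<in> J"
      unfolding J_def using left_idealD(1)[OF M_ideal] x by force
    ultimately have "J = UNIV"
      using M \<open>x \<notin> M\<close> by (auto simp: maximal_left_ideal_def)
    then obtain m l where ml: "1 = m + l" "m \<in> M" "l \<in> L"
      unfolding J_def by blast
    then have m: "m = 1 - l"
      by (simp add: eq_diff_eq)
    have "l * l = 0"
      using sq ml by blast
    then have "(1 + l) * m = 1"
      by (simp add: m algebra_simps)
    then have "y = (y * (1 + l)) * m" for y
      by (simp add: mult.assoc)
    then have "y \<in> M" for y
      using left_idealD(5)[OF M_ideal ml(2)] by metis
    then show False
      using \<open>M \<noteq> UNIV\<close> by blast
  qed
  then have "x \<in> jacobson_radical"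
    by (auto simp: jacobson_radical_def)
  then show ?thesis
    using ss unfolding semisimple_algebra_def by blast
qed

text \<open>The hypothesis makes all products within the left ideal generated by \<open>x\<close>
  vanish.\<close>

lemma semisimple_semiprime:
  assumes ss: "semisimple_algebra TYPE('a::complex_banach_algebra_1)"
    and x: "\<And>y. x * y * x = (0 :: 'a)"
  shows "x = 0"
proof (rule semisimple_square_zero_left_ideal[OF ss left_ideal_principal[of x]])
  show "u * v = 0" if "u \<in> range (\<lambda>a. a * x)" "v \<in> range (\<lambda>a. a * x)" for u v
    using that x by (auto simp: mult.assoc)
  show "x \<in> range (\<lambda>a. a * x)"
    by (rule image_eqI[of _ _ 1]) simp_all
qed

lemma minimal_left_idealD:
  assumes "minimal_left_ideal L"
  shows "left_ideal L" "L \<noteq> {0}" "\<And>J. left_ideal J \<Longrightarrow> J \<subseteq> L \<Longrightarrow> J \<noteq> {0} \<Longrightarrow> J = L"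
  using assms by (auto simp: minimal_left_ideal_def)

text \<open>Brauer's lemma. Semisimplicity gives \<open>z * y \<noteq> 0\<close> in
  \<open>L\<close>, so by minimality \<open>L y = L\<close> and no nonzero element of
  \<open>L\<close> annihilates \<open>y\<close>. Some \<open>e\<close> in \<open>L\<close> then has
  \<open>e * y = y\<close>, and \<open>z * e - z\<close> annihilates \<open>y\<close> for each
  \<open>z\<close> in \<open>L\<close>.\<close>

lemma minimal_left_ideal_idempotent:
  assumes ss: "semisimple_algebra TYPE('a::complex_banach_algebra_1)"
    and L: "minimal_left_ideal (L :: 'a set)"
  obtains e where "e \<in> L" "e * e = e" "e \<noteq> 0" "\<And>z. z \<in> L \<Longrightarrow> z * e = z"
proof -
  note LI = minimal_left_idealD(1)[OF L]
  obtain y where y: "y \<in> L" "y \<noteq> 0"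
    using minimal_left_idealD(2)[OF L] left_idealD(1)[OF LI] by blast
  obtain z y where zy: "z \<in> L" "y \<in> L" "z * y \<noteq> 0"
    using semisimple_square_zero_left_ideal[OF ss LI _ y(1)] y(2) by blast
  have "(\<lambda>x. x * y) ` L = L"
    using zy left_idealD(5)[OF LI]
    by (intro minimal_left_idealD(3)[OF L left_ideal_image_mult_right[OF LI]]) auto
  then obtain e where e: "e \<in> L" "e * y = y"
    using zy(2) by (metis imageE)
  have ann: "left_ideal {x \<in> L. x * y = 0}"
    using left_idealD[OF LI]
    by (intro left_idealI) (simp_all add: distrib_right mult_scaleC_left mult.assoc)
  have "{x \<in> L. x * y = 0} = {0}"
    using minimal_left_idealD(3)[OF L ann] zy by blast
  then have unit: "x = 0" if "x \<in> L" "x * y = 0" for x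
    using that by blast
  have right: "z * e = z" if "z \<in> L" for z
    using unit[of "z * e - z"] that e left_idealD(4,5)[OF LI]
    by (simp add: left_diff_distrib mult.assoc)
  show ?thesis
    using that[of e] e right zy by fastforce
qed

text \<open>A nonzero \<open>z\<close> in \<open>eAe\<close> lies in \<open>L\<close> and by
  minimality generates it, hence has a left inverse relative to \<open>e\<close>.\<close>

lemma minimal_left_ideal_corner:
  fixes e :: "'a::complex_banach_algebra_1"
  assumes L: "minimal_left_ideal L" and e: "e \<in> L" "e * e = e"
  shows "\<exists>c. e * x * e = c *\<^sub>C e"
proof (rule corner_scalar[OF e(2)])
  note LI = minimal_left_idealD(1)[OF L]
  fix z assume z: "e * z = z" "z * e = z" "z \<noteq> 0"
  have "z \<in> L"
    using left_idealD(5)[OF LI e(1), of z] z by simp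
  moreover have "z \<in> range (\<lambda>a. a * z)"
    by (rule image_eqI[of _ _ 1]) simp_all
  ultimately have "range (\<lambda>a. a * z) = L"
    using z left_idealD(5)[OF LI]
    by (intro minimal_left_idealD(3)[OF L left_ideal_principal]) auto
  then show "\<exists>w. w * z = e"
    using e(1) by (metis imageE)
qed (use e in \<open>simp_all add: mult.assoc\<close>, metis mult.assoc)

text \<open>Right multiplication by \<open>v\<close> is a map of left modules, so left ideals inside
  the image pull back to left ideals inside \<open>L\<close>. This puts \<open>L v\<close> into the
  socle even though the socle is built from left ideals.\<close>

lemma minimal_left_ideal_mult_right:
  fixes L :: "'a::complex_banach_algebra_1 set"
  assumes L: "minimal_left_ideal L" and nz: "(\<lambda>x. x * v) ` L \<noteq> {0}"
  shows "minimal_left_ideal ((\<lambda>x. x * v) ` L)"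
  unfolding minimal_left_ideal_def
proof (intro conjI allI impI nz)
  note LI = minimal_left_idealD(1)[OF L]
  show "left_ideal ((\<lambda>x. x * v) ` L)"
    by (rule left_ideal_image_mult_right[OF LI])
  fix J assume J: "left_ideal J \<and> J \<subseteq> (\<lambda>x. x * v) ` L"
  note JI = left_idealD[OF conjunct1[OF J]]
  have "left_ideal {x \<in> L. x * v \<in> J}"
    using LI J by (blast intro: left_ideal_vimage_mult_right)
  then consider "{x \<in> L. x * v \<in> J} = {0}" | "{x \<in> L. x * v \<in> J} = L"
    using minimal_left_idealD(3)[OF L] by blast
  then show "J = {0} \<or> J = (\<lambda>x. x * v) ` L"
  proof cases
    case 1
    have "j = 0" if j: "j \<in> J" for j
    proof -
      obtain x where x: "x \<in> L" "j = x * v"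
        using J j by blast
      then have "x = 0"
        using 1 j by blast
      then show ?thesis
        by (simp add: x)
    qed
    then show ?thesis
      using JI(1) by blast
  next
    case 2
    then show ?thesis
      using J by blast
  qed
qed

section \<open>Center, socle, and bounds for spectrum and dimension\<close>

lemma subspace_algebra_center:
  "complex_vector.subspace (algebra_center :: 'a::complex_banach_algebra_1 set)"
  unfolding complex_vector.subspace_def algebra_center_def
  by (auto simp: distrib_left distrib_right mult_scaleC_left mult_scaleC_right)

lemma minimal_left_ideal_subset_socle: "minimal_left_ideal L \<Longrightarrow> L \<subseteq> socle"
  by (auto simp: socle_def intro: complex_vector.span_base)

text \<open>\<open>y\<close> is a zero of the polynomial \<open>p(X) = X (X^2 - t X + d)\<close>. If
  \<open>p(c) \<noteq> 0\<close>, then \<open>y - c\<close> is invertible; the factor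
  \<open>c\<close> of \<open>p(c)\<close> is nonzero here.\<close>

lemma cubic_root_of_nonzero_spectrum:
  fixes y :: "'a::complex_banach_algebra_1"
  assumes y: "y * y * y = t *\<^sub>C (y * y) - d *\<^sub>C y" and c: "c \<in> nonzero_spectrum y"
  shows "c * c - t * c + d = 0"
proof (rule ccontr)
  assume nz: "c * c - t * c + d \<noteq> 0"
  have c0: "c \<noteq> 0" and spec: "c \<in> algebra_spectrum y"
    using c by (auto simp: nonzero_spectrum_def)
  define k where "k = c * (c * c - t * c + d)"
  have "k \<noteq> 0"
    using nz c0 by (simp add: k_def)
  \<comment> \<open>\<open>k\<close> is \<open>p(c)\<close>, and \<open>q\<close> is the quotient of
    \<open>p(X) - p(c)\<close> by \<open>X - c\<close>, evaluated at \<open>y\<close>.\<close>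
  define q where "q = y * y + (c - t) *\<^sub>C y + (c * c - t * c + d) *\<^sub>C 1"
  have y': "y * (y * y) = t *\<^sub>C (y * y) - d *\<^sub>C y"
    using y by (simp add: mult.assoc)
  have "(y - c *\<^sub>C 1) * q = (- k) *\<^sub>C 1" "q * (y - c *\<^sub>C 1) = (- k) *\<^sub>C 1"
    by (simp_all add: q_def k_def algebra_simps mult_scaleC_left mult_scaleC_right y'
        scaleC_scaleC scaleC_add_left scaleC_add_right)
  then have "(y - c *\<^sub>C 1) * ((- 1 / k) *\<^sub>C q) = 1" "((- 1 / k) *\<^sub>C q) * (y - c *\<^sub>C 1) = 1"
    using \<open>k \<noteq> 0\<close> by (simp_all add: mult_scaleC_left mult_scaleC_right scaleC_scaleC)
  then show False
    using spec unfolding algebra_spectrum_def mem_Collect_eq by blast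
qed

lemma extended_card_mono: "A \<subseteq> B \<Longrightarrow> extended_card A \<le> extended_card B"
  by (auto simp: extended_card_def card_mono dest: finite_subset)

text \<open>By Vieta, beside a root \<open>b\<close> only \<open>t - b\<close> is possible.\<close>

lemma extended_card_quadratic_roots:
  assumes "\<And>c. c \<in> S \<Longrightarrow> c * c - t * c + d = (0::complex)"
  shows "extended_card S \<le> 2"
proof (cases "S = {}")
  case False
  then obtain b where b: "b \<in> S"
    by blast
  have "c \<in> {b, t - b}" if "c \<in> S" for c
  proof -
    have "(c - b) * (c + b - t) = 0"
      using assms[OF that] assms[OF b] by algebra
    then have "c = b \<or> c = t - b"
      by (simp add: eq_diff_eq)
    then show ?thesis
      by simp
  qed
  then have "S \<subseteq> {b, t - b}"
    by blast
  then have "extended_card S \<le> extended_card {b, t - b}"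
    by (rule extended_card_mono)
  also have "\<dots> \<le> 2"
    by (simp add: extended_card_def numeral_eq_enat card_insert_if)
  finally show ?thesis .
qed (simp add: extended_card_def zero_enat_def[symmetric])

text \<open>If \<open>V\<close> lies in a finite span, it has a finite basis, and the exchange lemma
  compares it with \<open>S\<close>; otherwise the dimension is infinite.\<close>

lemma complex_dim_ge_card:
  assumes ind: "complex_vector.independent S" and S: "S \<subseteq> V" "finite S"
  shows "enat (card S) \<le> complex_dim V"
proof (cases "\<exists>B. finite B \<and> V \<subseteq> complex_vector.span B")
  case True
  then obtain B0 where B0: "finite B0" "V \<subseteq> complex_vector.span B0"
    by blast
  obtain B where B: "B \<subseteq> V" "complex_vector.independent B" "V \<subseteq> complex_vector.span B"
      "card B = complex_vector.dim V"
    using complex_vector.basis_exists by blast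
  have "finite B"
    using complex_vector.independent_span_bound[OF B0(1) B(2)] B(1) B0(2) by blast
  then have "card S \<le> card B"
    using complex_vector.independent_span_bound[OF _ ind] S B(3) by blast
  then show ?thesis
    using True B(4) by (simp add: complex_dim_def)
next
  case False
  then have "complex_dim V = \<infinity>"
    unfolding complex_dim_def by (rule if_not_P)
  then show ?thesis
    by simp
qed

section \<open>Central socle\<close>

text \<open>Mixed products vanish, so combinations multiply coordinatewise, like functions on
  \<open>E\<close>.\<close>

lemma orthogonal_idempotents_sum_mult:
  fixes E :: "'a::complex_banach_algebra_1 set"
  assumes E: "finite E" "\<And>e. e \<in> E \<Longrightarrow> e * e = e"
    "\<And>e f. e \<in> E \<Longrightarrow> f \<in> E \<Longrightarrow> e \<noteq> f \<Longrightarrow> e * f = 0"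
  shows "(\<Sum>e\<in>E. s e *\<^sub>C e) * (\<Sum>e\<in>E. t e *\<^sub>C e) = (\<Sum>e\<in>E. (s e * t e) *\<^sub>C e)"
proof -
  have "(\<Sum>f\<in>E. (s e *\<^sub>C e) * (t f *\<^sub>C f)) = (s e * t e) *\<^sub>C e" if e: "e \<in> E" for e
  proof -
    have "(\<Sum>f\<in>E. (s e *\<^sub>C e) * (t f *\<^sub>C f)) = (\<Sum>f\<in>E. if f = e then (s e * t e) *\<^sub>C e else 0)"
      using E(2,3) e
      by (intro sum.cong) (auto simp: mult_scaleC_left mult_scaleC_right scaleC_scaleC)
    then show ?thesis
      using E(1) e by simp
  qed
  then show ?thesis
    by (simp add: sum_product)
qed

lemma orthogonal_idempotents_independent:
  fixes E :: "'a::complex_banach_algebra_1 set"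
  assumes E: "finite E" "\<And>e. e \<in> E \<Longrightarrow> e * e = e" "0 \<notin> E"
    "\<And>e f. e \<in> E \<Longrightarrow> f \<in> E \<Longrightarrow> e \<noteq> f \<Longrightarrow> e * f = 0"
  shows "complex_vector.independent E"
proof (rule complex_vector.independent_if_scalars_zero[OF E(1)])
  fix s e assume s: "(\<Sum>e\<in>E. s e *\<^sub>C e) = 0" and e: "e \<in> E"
  \<comment> \<open>The second factor is \<open>e\<close> itself, written with indicator
    coefficients; it isolates the coefficient of \<open>e\<close>.\<close>
  have "0 = (\<Sum>f\<in>E. s f *\<^sub>C f) * (\<Sum>f\<in>E. (if f = e then 1 else 0) *\<^sub>C f)"
    by (simp add: s)
  also have "\<dots> = (\<Sum>f\<in>E. (s f * (if f = e then 1 else 0)) *\<^sub>C f)"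
    by (rule orthogonal_idempotents_sum_mult[OF E(1,2,4)])
  also have "\<dots> = (\<Sum>f\<in>E. if f = e then s e *\<^sub>C e else 0)"
    by (intro sum.cong) auto
  also have "\<dots> = s e *\<^sub>C e"
    using E(1) e by simp
  finally show "s e = 0"
    using E(3) e by auto
qed

text \<open>The sum acts as \<open>s e\<close> on each summand and as 0 on the complement of all
  summands. Whether that complement is trivial affects only the value 0, which is discarded.\<close>

lemma orthogonal_idempotents_nonzero_spectrum:
  fixes E :: "'a::complex_banach_algebra_1 set"
  assumes E: "finite E" "\<And>e. e \<in> E \<Longrightarrow> e * e = e" "0 \<notin> E"
    "\<And>e f. e \<in> E \<Longrightarrow> f \<in> E \<Longrightarrow> e \<noteq> f \<Longrightarrow> e * f = 0"
  shows "nonzero_spectrum (\<Sum>e\<in>E. s e *\<^sub>C e) = s ` E - {0}"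
proof (intro equalityI subsetI)
  let ?y = "\<Sum>e\<in>E. s e *\<^sub>C e"
  have mult: "(\<Sum>e\<in>E. s e *\<^sub>C e) * (\<Sum>e\<in>E. t e *\<^sub>C e) = (\<Sum>e\<in>E. (s e * t e) *\<^sub>C e)" for s t
    by (rule orthogonal_idempotents_sum_mult[OF E(1,2,4)])
  {
    fix c assume c: "c \<in> nonzero_spectrum ?y"
    show "c \<in> s ` E - {0}"
    proof (rule ccontr)
      assume "c \<notin> s ` E - {0}"
      moreover have c0: "c \<noteq> 0" and spec: "c \<in> algebra_spectrum ?y"
        using c by (auto simp: nonzero_spectrum_def)
      ultimately have ne: "s e - c \<noteq> 0" if "e \<in> E" for e
        using that by auto
      \<comment> \<open>The inverse of \<open>?y - c\<close> is \<open>1 / (s e - c) = t e - 1 / c\<close> on the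
        summand \<open>e\<close> and \<open>- 1 / c\<close> on the complement of all summands.\<close>
      define t where "t e = s e / (c * (s e - c))" for e
      let ?t = "\<Sum>e\<in>E. t e *\<^sub>C e"
      have st: "s e * t e = c * t e + s e / c" if "e \<in> E" for e
        using ne[OF that] c0 by (simp add: t_def field_simps)
      have eq: "(\<Sum>e\<in>E. (s e * t e) *\<^sub>C e) = c *\<^sub>C ?t + (1 / c) *\<^sub>C ?y"
        by (simp add: st scaleC_add_left sum.distrib complex_vector.scale_sum_right scaleC_scaleC)
      have "?y * ?t = c *\<^sub>C ?t + (1 / c) *\<^sub>C ?y" "?t * ?y = c *\<^sub>C ?t + (1 / c) *\<^sub>C ?y"
        by (simp_all add: mult eq flip: mult.commute[of "s _" "t _"])
      then have "(?y - c *\<^sub>C 1) * (?t - (1 / c) *\<^sub>C 1) = 1" "(?t - (1 / c) *\<^sub>C 1) * (?y - c *\<^sub>C 1) = 1"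
        using c0 by (simp_all add: left_diff_distrib right_diff_distrib mult_scaleC_left
            mult_scaleC_right scaleC_scaleC complex_vector.scale_right_diff_distrib)
      then show False
        using spec unfolding algebra_spectrum_def mem_Collect_eq by blast
    qed
  next
    fix c assume c: "c \<in> s ` E - {0}"
    then obtain e where e: "e \<in> E" "c = s e"
      by blast
    \<comment> \<open>\<open>e\<close> is an eigenvector for \<open>c\<close>: it is killed by
      \<open>?y - c\<close>, which therefore has no left inverse.\<close>
    have "?y * e = (\<Sum>f\<in>E. if f = e then s e *\<^sub>C e else 0)"
      unfolding sum_distrib_right using E(2,4) e
      by (intro sum.cong) (auto simp: mult_scaleC_left)
    then have "(?y - c *\<^sub>C 1) * e = 0"
      using E(1) e by (simp add: left_diff_distrib mult_scaleC_left)
    then have ann: "w * (?y - c *\<^sub>C 1) * e = 0" for w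
      by (simp add: mult.assoc)
    have "w * (?y - c *\<^sub>C 1) \<noteq> 1" for w
    proof
      assume "w * (?y - c *\<^sub>C 1) = 1"
      from ann[of w, unfolded this] have "e = 0"
        by simp
      with e(1) E(3) show False
        by simp
    qed
    then have "c \<in> algebra_spectrum ?y"
      unfolding algebra_spectrum_def by blast
    then show "c \<in> nonzero_spectrum ?y"
      using c by (simp add: nonzero_spectrum_def)
  }
qed

text \<open>Both sides equal \<open>card E\<close>. By \<open>abs\<close>, each \<open>x * a\<close>
  is again a combination of \<open>E\<close>, so it has at most \<open>card E\<close> nonzero
  spectral values. As \<open>r\<close> has no zeros on \<open>E\<close>, the coefficients can be
  prescribed through \<open>x\<close>.\<close>

lemma dim_eq_rank_orthogonal_sum:
  fixes E :: "'a::complex_banach_algebra_1 set"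
  assumes E: "finite E" "\<And>e. e \<in> E \<Longrightarrow> e * e = e" "0 \<notin> E"
    "\<And>e f. e \<in> E \<Longrightarrow> f \<in> E \<Longrightarrow> e \<noteq> f \<Longrightarrow> e * f = 0"
    and abs: "\<And>e x. e \<in> E \<Longrightarrow> \<exists>c. x * e = c *\<^sub>C e"
    and r: "\<And>e. e \<in> E \<Longrightarrow> r e \<noteq> 0" and a: "a = (\<Sum>e\<in>E. r e *\<^sub>C e)"
  shows "complex_dim {a * x * a | x. True} = spectral_rank a"
proof -
  have mult: "(\<Sum>e\<in>E. s e *\<^sub>C e) * (\<Sum>e\<in>E. t e *\<^sub>C e) = (\<Sum>e\<in>E. (s e * t e) *\<^sub>C e)" for s t
    by (rule orthogonal_idempotents_sum_mult[OF E(1,2,4)])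
  have spectrum: "nonzero_spectrum (\<Sum>e\<in>E. s e *\<^sub>C e) = s ` E - {0}" for s
    by (rule orthogonal_idempotents_nonzero_spectrum[OF E])
  define k where "k x e = (SOME c. x * e = c *\<^sub>C e)" for x e :: 'a
  have k: "x * e = k x e *\<^sub>C e" if "e \<in> E" for x e :: 'a
    unfolding k_def by (rule someI_ex[OF abs[OF that]])
  have xa: "x * a = (\<Sum>e\<in>E. (r e * k x e) *\<^sub>C e)" for x
    unfolding a sum_distrib_left by (simp add: mult_scaleC_right k scaleC_scaleC)
  have "{a * x * a | x. True} = complex_vector.span E"
  proof (intro equalityI subsetI)
    fix y assume "y \<in> {a * x * a | x. True}"
    then show "y \<in> complex_vector.span E"
      by (auto simp: xa intro: complex_vector.span_sum complex_vector.span_scale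
          complex_vector.span_base)
  next
    fix y assume "y \<in> complex_vector.span E"
    then obtain s where s: "y = (\<Sum>e\<in>E. s e *\<^sub>C e)"
      using E(1) by (auto simp: complex_vector.span_finite)
    \<comment> \<open>The denominator cancels the factor \<open>r e\<close> contributed by each of
      the two copies of \<open>a\<close>.\<close>
    have "a * (\<Sum>e\<in>E. (s e / (r e * r e)) *\<^sub>C e) * a = y"
      unfolding a mult s by (intro sum.cong) (auto simp: r)
    then show "y \<in> {a * x * a | x. True}"
      by blast
  qed
  then have "complex_dim {a * x * a | x. True} = enat (card E)"
    using complex_vector.dim_span_eq_card_independent[OF orthogonal_idempotents_independent[OF E]]
      E(1) by (auto simp: complex_dim_def)
  moreover have "spectral_rank a = enat (card E)"
  proof (rule antisym)
    show "spectral_rank a \<le> enat (card E)"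
      unfolding spectral_rank_def
    proof (rule SUP_least)
      fix x
      have "card ((\<lambda>e. r e * k x e) ` E - {0}) \<le> card E"
        using E(1) by (meson card_Diff1_le card_image_le finite_imageI order.trans)
      then show "extended_card (nonzero_spectrum (x * a)) \<le> enat (card E)"
        using E(1) unfolding xa spectrum by (simp add: extended_card_def)
    qed
    \<comment> \<open>The bound is attained with distinct nonzero coefficients: a numbering of
      \<open>E\<close>, shifted by \<open>Suc\<close> to avoid 0.\<close>
    obtain h :: "'a \<Rightarrow> nat" where h: "inj_on h E"
      using E(1) finite_imp_inj_to_nat_seg by blast
    define s where "s e = (of_nat (Suc (h e)) :: complex)" for e
    have "inj_on s E" "0 \<notin> s ` E"
      using h by (auto simp: s_def inj_on_def simp del: of_nat_Suc)
    moreover have "(\<Sum>e\<in>E. (s e / r e) *\<^sub>C e) * a = (\<Sum>e\<in>E. s e *\<^sub>C e)"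
      unfolding a mult by (intro sum.cong) (auto simp: r)
    ultimately have eq: "enat (card E) = extended_card (nonzero_spectrum ((\<Sum>e\<in>E. (s e / r e) *\<^sub>C e) * a))"
      using E(1) by (simp add: spectrum extended_card_def card_image)
    show "enat (card E) \<le> spectral_rank a"
      unfolding spectral_rank_def eq by (rule SUP_upper[OF UNIV_I])
  qed
  ultimately show ?thesis
    by simp
qed

text \<open>Centrality turns \<open>x * e\<close> into \<open>e * x * e\<close>, a multiple of
  \<open>e\<close>, so the socle is spanned by \<open>P\<close>. Distinct elements of
  \<open>P\<close> are orthogonal, so any expansion of \<open>a\<close> over \<open>P\<close> is an
  orthogonal one.\<close>

lemma socle_central_imp_dim_eq_rank:
  assumes ss: "semisimple_algebra TYPE('a::complex_banach_algebra_1)"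
    and cen: "(socle :: 'a set) \<subseteq> algebra_center" and a: "a \<in> (socle :: 'a set)"
  shows "complex_dim {a * x * a | x. True} = spectral_rank a"
proof -
  define P :: "'a set" where
    "P = {e. e * e = e \<and> e \<noteq> 0 \<and> e \<in> algebra_center \<and> (\<forall>x. \<exists>c. x * e = c *\<^sub>C e)}"
  have "L \<subseteq> complex_vector.span P" if L: "minimal_left_ideal L" for L
  proof
    fix z assume z: "z \<in> L"
    obtain e where e: "e \<in> L" "e * e = e" "e \<noteq> 0" "\<And>z. z \<in> L \<Longrightarrow> z * e = z"
      using minimal_left_ideal_idempotent[OF ss L] by blast
    have ecen: "e \<in> algebra_center"
      using e(1) cen minimal_left_ideal_subset_socle[OF L] by blast
    have abs: "\<exists>c. x * e = c *\<^sub>C e" for x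
    proof -
      have "x * e = e * x * e"
        using ecen e(2) by (metis (mono_tags, lifting) algebra_center_def mem_Collect_eq mult.assoc)
      then show ?thesis
        using minimal_left_ideal_corner[OF L e(1,2)] by metis
    qed
    then have "e \<in> P"
      using e ecen by (simp add: P_def)
    moreover obtain c where "z = c *\<^sub>C e"
      using abs e(4)[OF z] by metis
    ultimately show "z \<in> complex_vector.span P"
      by (simp add: complex_vector.span_base complex_vector.span_scale)
  qed
  then have "(socle :: 'a set) \<subseteq> complex_vector.span P"
    unfolding socle_def by (intro complex_vector.span_minimal) auto
  then obtain r where r: "finite {e. r e \<noteq> 0}" "\<And>e. r e \<noteq> 0 \<Longrightarrow> e \<in> P"
      "a = (\<Sum>e | r e \<noteq> 0. r e *\<^sub>C e)"
    using a unfolding complex_vector.span_explicit' by blast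
  \<comment> \<open>A nonzero \<open>e * f\<close> is a multiple of both \<open>e\<close> and
    \<open>f\<close>; idempotency makes both scalars 1, so \<open>e = f\<close>.\<close>
  have orth: "e * f = 0" if e: "e \<in> P" and f: "f \<in> P" and ne: "e \<noteq> f" for e f
  proof (rule ccontr)
    assume nz: "e * f \<noteq> 0"
    have comm: "e * f = f * e"
      using e by (auto simp: P_def algebra_center_def)
    obtain c d where cd: "e * f = c *\<^sub>C f" "f * e = d *\<^sub>C e"
      using e f by (auto simp: P_def) metis
    have "e * (e * f) = e * f" "f * (e * f) = e * f"
      using e f comm by (auto simp: P_def) (metis mult.assoc)+
    then have "c *\<^sub>C (e * f) = e * f" "d *\<^sub>C (e * f) = e * f"
      using cd comm by (metis mult_scaleC_right)+
    then have "(c - 1) *\<^sub>C (e * f) = 0" "(d - 1) *\<^sub>C (e * f) = 0"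
      by (simp_all add: complex_vector.scale_left_diff_distrib scaleC_one)
    then have "c = 1" "d = 1"
      using nz by simp_all
    then show False
      using cd comm ne by simp
  qed
  show ?thesis
  proof (rule dim_eq_rank_orthogonal_sum[OF r(1) _ _ _ _ _ r(3)])
    show "0 \<notin> {e. r e \<noteq> 0}"
      using r(2)[of 0] P_def by auto
    fix e assume "e \<in> {e. r e \<noteq> 0}"
    then have e: "r e \<noteq> 0" "e \<in> P"
      using r(2) by auto
    show "r e \<noteq> 0" "e * e = e" "\<exists>c. x * e = c *\<^sub>C e" for x
      using e by (auto simp: P_def)
    show "e * f = 0" if "f \<in> {e. r e \<noteq> 0}" "e \<noteq> f" for f
      using that r(2) by (intro orth[OF e(2)]) auto
  qed
qed

section \<open>Dimension equal to rank\<close>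

text \<open>The claim is \<open>(1 - e) * x * e = 0\<close>. A nonzero value yields a socle element
  of rank at most 2 with three independent elements in its corner.\<close>

lemma dim_eq_rank_imp_mult_eq_corner:
  assumes rank: "\<And>a. a \<in> (socle :: 'a::complex_banach_algebra_1 set) \<Longrightarrow>
      complex_dim {a * x * a | x. True} = spectral_rank a"
    and L: "minimal_left_ideal (L :: 'a set)"
    and e: "e \<in> L" "e * e = e" "e \<noteq> 0"
  shows "x * e = e * x * e"
proof (rule ccontr)
  assume "x * e \<noteq> e * x * e"
  define u where "u = x * e - e * x * e"
  note LI = minimal_left_idealD(1)[OF L]
  have u0: "u \<noteq> 0"
    using \<open>x * e \<noteq> e * x * e\<close> by (simp add: u_def)
  have eu: "e * u = 0" and ue: "u * e = u"
    using e(2) by (simp_all add: u_def left_diff_distrib right_diff_distrib mult.assoc)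
      (simp add: e(2) flip: mult.assoc)
  have "u \<in> L"
    using left_idealD(4,5)[OF LI] e(1) by (simp add: u_def)
  then have "range (\<lambda>a. a * u) \<subseteq> L"
    using left_idealD(5)[OF LI] by blast
  moreover have "u \<in> range (\<lambda>a. a * u)"
    by (rule image_eqI[of _ _ 1]) simp_all
  ultimately have "range (\<lambda>a. a * u) = L"
    using u0 by (intro minimal_left_idealD(3)[OF L left_ideal_principal]) auto
  then obtain y where y: "y * u = e"
    using e(1) by (metis imageE)
  \<comment> \<open>\<open>v\<close> is \<open>e * y * (1 - e)\<close>; as \<open>e * u = 0\<close>,
    the correction does not disturb \<open>v * u = e\<close>.\<close>
  define v where "v = e * y - e * y * e"
  have vu: "v * u = e"
    by (simp add: v_def left_diff_distrib mult.assoc y eu e(2))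
  have ve: "v * e = 0"
    by (simp add: v_def left_diff_distrib mult.assoc e(2))
  have ev: "e * v = v"
    by (simp add: v_def right_diff_distrib e(2) flip: mult.assoc)
  \<comment> \<open>From here on \<open>e\<close>, \<open>u\<close>, \<open>v\<close>, \<open>f\<close> multiply like the matrix units of the 2 by 2 matrices.\<close>
  define f where "f = u * v"
  have uu: "u * u = 0"
    by (metis eu ue mult.assoc mult_zero_right)
  have vv: "v * v = 0"
    by (metis ev ve mult.assoc mult_zero_left)
  have prods: "e * f = 0" "u * f = 0" "v * f = v" "f * e = 0" "f * u = u" "f * v = 0" "f * f = f"
    unfolding f_def by (metis eu ue ev ve uu vv vu mult.assoc mult_zero_left mult_zero_right)+
  note table = e(2) eu ue vu ve ev uu vv f_def[symmetric] prods
  define a where "a = e + f"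
  have aa: "a * a = a"
    by (simp add: a_def algebra_simps table)
  have "f \<in> (\<lambda>x. x * v) ` L"
    using \<open>u \<in> L\<close> by (simp add: f_def)
  moreover have "f \<noteq> 0"
    using \<open>f * u = u\<close> u0 by auto
  ultimately have "f \<in> socle"
    using minimal_left_ideal_subset_socle[OF minimal_left_ideal_mult_right[OF L, of v]] by blast
  moreover have "e \<in> socle"
    using minimal_left_ideal_subset_socle[OF L] e(1) by blast
  ultimately have "a \<in> socle"
    by (simp add: a_def socle_def complex_vector.span_add)

  have "spectral_rank a \<le> 2"
    unfolding spectral_rank_def
  proof (rule SUP_least)
    fix x
    \<comment> \<open>\<open>p\<close>, \<open>q\<close>, \<open>r\<close>, \<open>s\<close> are the
      entries of \<open>a * x * a\<close> with respect to the matrix units \<open>e\<close>,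
      \<open>v\<close>, \<open>u\<close>, \<open>f\<close>.\<close>
    note corner = minimal_left_ideal_corner[OF L e(1,2)]
    obtain p where p: "e * x * e = p *\<^sub>C e"
      using corner by blast
    obtain q where q: "e * x * u = q *\<^sub>C e"
      using corner[of "x * u"] by (auto simp: mult.assoc ue)
    obtain r where r: "v * x * e = r *\<^sub>C e"
      using corner[of "v * x"] by (auto simp: ev simp flip: mult.assoc)
    obtain s where s: "v * x * u = s *\<^sub>C e"
      using corner[of "v * x * u"] by (auto simp: ue mult.assoc) (auto simp: ev simp flip: mult.assoc)
    let ?w = "a * x * a"
    have "?w = e * x * e + (e * x * u) * v + u * (v * x * e) + u * (v * x * u) * v"
      by (simp add: a_def f_def distrib_left distrib_right mult.assoc)
    then have w: "?w = p *\<^sub>C e + q *\<^sub>C v + r *\<^sub>C u + s *\<^sub>C f"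
      unfolding p q r s by (simp add: mult_scaleC_left mult_scaleC_right table)
    \<comment> \<open>Cayley--Hamilton for 2 by 2 matrices\<close>
    have ww: "?w * ?w = (p + s) *\<^sub>C ?w - (p * s - q * r) *\<^sub>C a"
      unfolding w unfolding a_def
      by (simp add: distrib_left distrib_right mult_scaleC_left mult_scaleC_right table
          scaleC_scaleC scaleC_add_left scaleC_add_right
          complex_vector.scale_left_diff_distrib mult.commute)
    \<comment> \<open>The rank concerns \<open>x * a\<close> rather than \<open>?w\<close>. Since
      \<open>a\<close> is idempotent, multiplying the quadratic relation for \<open>?w\<close> by
      \<open>x\<close> from the left gives a cubic one for \<open>x * a\<close> without constant
      term.\<close>
    have x2: "x * a * (x * a) = x * ?w"
      by (simp add: mult.assoc)
    have "x * a * (x * a) * (x * a) = x * (?w * ?w)"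
      by (simp add: mult.assoc) (metis aa mult.assoc)
    also have "\<dots> = (p + s) *\<^sub>C (x * a * (x * a)) - (p * s - q * r) *\<^sub>C (x * a)"
      unfolding ww x2 by (simp add: right_diff_distrib mult_scaleC_right)
    finally have "c * c - (p + s) * c + (p * s - q * r) = 0" if "c \<in> nonzero_spectrum (x * a)" for c
      using that by (rule cubic_root_of_nonzero_spectrum)
    then show "extended_card (nonzero_spectrum (x * a)) \<le> 2"
      by (rule extended_card_quadratic_roots)
  qed
  moreover have "enat (card {v, u, e}) \<le> complex_dim {a * x * a | x. True}"
  proof (rule complex_dim_ge_card)
    \<comment> \<open>Left multiplication by \<open>e\<close> fixes \<open>e\<close> and kills
      \<open>u\<close>; right multiplication by \<open>e\<close> fixes \<open>u\<close> and
      \<open>e\<close> and kills \<open>v\<close>.\<close>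
    have "k *\<^sub>C e \<noteq> u" for k
      using arg_cong[of "k *\<^sub>C e" u "\<lambda>z. e * z"] e u0 eu by (auto simp: mult_scaleC_right)
    moreover have "v \<noteq> k *\<^sub>C u + l *\<^sub>C e" for k l
    proof
      assume v: "v = k *\<^sub>C u + l *\<^sub>C e"
      have "v * e = k *\<^sub>C u + l *\<^sub>C e"
        unfolding v by (simp add: distrib_right mult_scaleC_left table)
      then show False
        using v ve vu e(3) by simp
    qed
    ultimately show "complex_vector.independent {v, u, e}"
      using e(3)
      by (auto simp: complex_vector.independent_insert complex_vector.span_insert
          complex_vector.span_empty complex_vector.independent_empty eq_diff_eq algebra_simps)
    have "a * z * a \<in> {a * x * a | x. True}" for z
      by blast
    from this[of e] this[of u] this[of v] show "{v, u, e} \<subseteq> {a * x * a | x. True}"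
      by (simp add: a_def distrib_left distrib_right table)
  qed simp
  moreover have "card {v, u, e} = 3"
  proof -
    have "e \<noteq> u" "e \<noteq> v" "u \<noteq> v"
      using table u0 e(3) by metis+
    then show ?thesis
      by auto
  qed
  ultimately show False
    using rank[OF \<open>a \<in> socle\<close>] by (auto simp: numeral_eq_enat dest: order.trans)
qed

text \<open>The center is a subspace, so one minimal left ideal at a time suffices. There
  \<open>z = z * e = e * z * e\<close> is a multiple of \<open>e\<close>, and only \<open>e\<close>
  has to be shown central.\<close>

lemma dim_eq_rank_imp_socle_central:
  assumes ss: "semisimple_algebra TYPE('a::complex_banach_algebra_1)"
    and rank: "\<And>a. a \<in> (socle :: 'a set) \<Longrightarrow>
      complex_dim {a * x * a | x. True} = spectral_rank a"
  shows "(socle :: 'a set) \<subseteq> algebra_center"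
  unfolding socle_def
proof (rule complex_vector.span_minimal[OF _ subspace_algebra_center], rule Union_least, safe)
  fix L :: "'a set" and z assume L: "minimal_left_ideal L" and z: "z \<in> L"
  obtain e where e: "e \<in> L" "e * e = e" "e \<noteq> 0" "\<And>z. z \<in> L \<Longrightarrow> z * e = z"
    using minimal_left_ideal_idempotent[OF ss L] by blast
  have left: "x * e = e * x * e" for x
    by (rule dim_eq_rank_imp_mult_eq_corner[OF _ L e(1-3)]) (rule rank)
  have right: "e * x = e * x * e" for x
  proof -
    define u where "u = e * x - e * x * e"
    have "e * u = u" "u * e = 0"
      using e(2) by (simp_all add: u_def left_diff_distrib right_diff_distrib mult.assoc)
        (simp add: e(2) flip: mult.assoc)
    have "u * w * u = 0" for w
    proof -
      \<comment> \<open>Replacing \<open>w * e\<close> by \<open>e * w * e\<close> produces the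
        factor \<open>u * e = 0\<close>.\<close>
      have "u * w * u = u * (w * e) * u"
        using \<open>e * u = u\<close> by (simp add: mult.assoc)
      also have "\<dots> = (u * e) * (w * e * u)"
        by (subst left) (simp add: mult.assoc)
      finally show ?thesis
        using \<open>u * e = 0\<close> by simp
    qed
    then have "u = 0"
      by (rule semisimple_semiprime[OF ss])
    then show ?thesis
      by (simp add: u_def)
  qed
  have "e * x = x * e" for x
    by (rule trans[OF right left[symmetric]])
  then have "e \<in> algebra_center"
    unfolding algebra_center_def by blast
  moreover obtain c where "z = c *\<^sub>C e"
    using minimal_left_ideal_corner[OF L e(1,2), of z] left[of z] e(4)[OF z] by metis
  ultimately show "z \<in> algebra_center"
    using complex_vector.subspace_scale[OF subspace_algebra_center] by blast
qed

theorem theorem5p6: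
  assumes "semisimple_algebra TYPE('a::complex_banach_algebra_1)"
    and "(socle :: 'a set) \<noteq> {0}"
  shows "(socle :: 'a set) \<subseteq> algebra_center \<longleftrightarrow>
    (\<forall>a\<in>(socle :: 'a set). complex_dim {a * x * a | x. True} = spectral_rank a)"
  using socle_central_imp_dim_eq_rank[OF assms(1)] dim_eq_rank_imp_socle_central[OF assms(1)]
  by blast

end
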